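(* Let $G=(V,E)$ be a locally finite simple graph and $x\in V$. If there exist $\mathcal N_1<\mathcal N_2$ in $(0,\infty]$ such that $\mathcal K_{G,x}(\mathcal N_1)=\mathcal K_{G,x}(\mathcal N_2)$, then $$\mathcal K_{G,x}(\mathcal N)=\mathcal K_{G,x}(\mathcal N_1)\qquad\text{for all }\mathcal N\in[\mathcal N_1,\infty].$$
   Context: Graphs are undirected, without loops or multiple edges, and every vertex has finite degree; $d_x$ is the degree of $x$, and the vertex $x$ considered has $d_x\ge1$. For $f:V\to\mathbb R$ put $\Delta f(x)=\sum_{y\sim x}(f(y)-f(x))$ (non-normalized Laplacian), and for $f,g:V\to\mathbb R$ put $2\Gamma(f,g)=\Delta(fg)-f\Delta g-g\Delta f$, $2\Gamma_2(f,g)=\Delta\Gamma(f,g)-\Gamma(f,\Delta g)-\Gamma(\Delta f,g)$, $\Gamma(f)=\Gamma(f,f)$, $\Gamma_2(f)=\Gamma_2(f,f)$. For $\mathcal N\in(0,\infty]$ (convention $1/\infty=0$), $\mathcal K_{G,x}(\mathcal N)$ is the largest $K\in\mathbb R$ such that $\Gamma_2(f)(x)\ge\frac1{\mathcal N}(\Delta f(x))^2+K\,\Gamma(f)(x)$ for all $f:V\to\mathbb R$ (Bakry-Émery curvature function). *)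

theory Defs
  imports "HOL-Analysis.Analysis"
begin

definition neighbours :: "'a set set \<Rightarrow> 'a \<Rightarrow> 'a set" where
  "neighbours E x = {y. {x, y} \<in> E}"

definition vertex_degree :: "'a set set \<Rightarrow> 'a \<Rightarrow> nat" where
  "vertex_degree E x = card (neighbours E x)"

text \<open>Edges are two-element sets of vertices; neither \<open>V\<close> nor \<open>E\<close> need be finite.\<close>

locale locally_finite_graph =
  fixes V :: "'a set" and E :: "'a set set"
  assumes edges: "\<And>e. e \<in> E \<Longrightarrow> e \<subseteq> V \<and> card e = 2"
    and locally_finite: "\<And>x. x \<in> V \<Longrightarrow> finite (neighbours E x)"

text \<open>
  Functions on the vertex set are total functions on \<open>'a\<close>. At a vertex of a graph, all operators
  below depend only on the values on \<open>V\<close>, as neighbours of vertices lie in \<open>V\<close>.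
\<close>

definition laplacian :: "'a set set \<Rightarrow> ('a \<Rightarrow> real) \<Rightarrow> 'a \<Rightarrow> real" where
  "laplacian E f x = (\<Sum>y\<in>neighbours E x. f y - f x)"

definition Gamma_op :: "'a set set \<Rightarrow> ('a \<Rightarrow> real) \<Rightarrow> ('a \<Rightarrow> real) \<Rightarrow> 'a \<Rightarrow> real" where
  "Gamma_op E f g x =
     (laplacian E (\<lambda>y. f y * g y) x - f x * laplacian E g x - g x * laplacian E f x) / 2"

definition Gamma2_op :: "'a set set \<Rightarrow> ('a \<Rightarrow> real) \<Rightarrow> ('a \<Rightarrow> real) \<Rightarrow> 'a \<Rightarrow> real" where
  "Gamma2_op E f g x =
     (laplacian E (Gamma_op E f g) x - Gamma_op E f (laplacian E g) x
        - Gamma_op E (laplacian E f) g x) / 2"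

text \<open>
  The dimension \<open>N\<close> is meant to range over \<open>(0, \<infinity>]\<close>. There the quotient \<open>1 / N\<close> in \<^typ>\<open>ereal\<close>
  is finite, with \<open>1 / \<infinity> = 0\<close>.
\<close>

definition curvature_dimension :: "'a set set \<Rightarrow> 'a \<Rightarrow> ereal \<Rightarrow> real \<Rightarrow> bool" where
  "curvature_dimension E x N K \<longleftrightarrow>
     (\<forall>f :: 'a \<Rightarrow> real.
        Gamma2_op E f f x \<ge> real_of_ereal (1 / N) * (laplacian E f x)\<^sup>2 + K * Gamma_op E f f x)"

text \<open>
  The maximum exists whenever \<open>x\<close> is a vertex with at least one neighbour in a locally finite graph
  and \<open>N > 0\<close>; otherwise the value may be unspecified.
\<close>

definition curvature_function :: "'a set set \<Rightarrow> 'a \<Rightarrow> ereal \<Rightarrow> real" where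
  "curvature_function E x N = (GREATEST K. curvature_dimension E x N K)"

end

theory Submission
  imports Defs
begin

text \<open>
  Write \<open>t = 1 / N\<close>. For fixed \<open>f\<close> the curvature-dimension inequality is affine in \<open>(t, K)\<close>, so the
  set of admissible pairs is convex, and the curvature is a concave nonincreasing function of \<open>t\<close>.
  If such a function takes equal values at \<open>s < t\<close>, concavity prevents it from being larger to the
  left of \<open>s\<close>, so it is constant on \<open>[0, t]\<close>. The greatest \<open>K\<close> exists because \<open>\<Gamma>\<^sub>2(f)(x)\<close> is
  bounded below by a multiple of \<open>\<Gamma>(f)(x)\<close>.
\<close>

lemma Gamma_op_eq:
  "Gamma_op E f g x = (\<Sum>y\<in>neighbours E x. (f y - f x) * (g y - g x)) / 2"
proof -
  have "(\<Sum>y\<in>neighbours E x. f y * g y - f x * g x)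
        - f x * (\<Sum>y\<in>neighbours E x. g y - g x) - g x * (\<Sum>y\<in>neighbours E x. f y - f x)
      = (\<Sum>y\<in>neighbours E x. (f y - f x) * (g y - g x))"
    unfolding sum_distrib_left sum_subtractf[symmetric]
    by (rule sum.cong) (auto simp: algebra_simps)
  then show ?thesis
    by (simp add: Gamma_op_def laplacian_def)
qed

lemma Gamma_op_self_eq: "Gamma_op E f f x = (\<Sum>y\<in>neighbours E x. (f y - f x)\<^sup>2) / 2"
  by (simp add: Gamma_op_eq power2_eq_square)

lemma Gamma_op_self_nonneg: "Gamma_op E f f x \<ge> 0"
  by (simp add: Gamma_op_self_eq sum_nonneg)

lemma laplacian_square_le:
  "(laplacian E f x)\<^sup>2 \<le> 2 * real (vertex_degree E x) * Gamma_op E f f x"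
  using Cauchy_Schwarz_ineq_sum[of "\<lambda>_. 1" "\<lambda>y. f y - f x" "neighbours E x"]
  by (simp add: laplacian_def vertex_degree_def Gamma_op_self_eq)

lemma Gamma2_op_self_eq:
  "2 * Gamma2_op E f f x =
     (\<Sum>y\<in>neighbours E x. Gamma_op E f f y - (f y - f x) * laplacian E f y)
       - real (vertex_degree E x) * Gamma_op E f f x + (laplacian E f x)\<^sup>2"
proof -
  let ?N = "neighbours E x"
  have "Gamma_op E f (laplacian E f) x = Gamma_op E (laplacian E f) f x"
    by (simp add: Gamma_op_eq mult.commute)
  then have "2 * Gamma2_op E f f x
      = laplacian E (Gamma_op E f f) x - 2 * Gamma_op E f (laplacian E f) x"
    by (simp add: Gamma2_op_def)
  also have "\<dots> = (\<Sum>y\<in>?N. Gamma_op E f f y - Gamma_op E f f x)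
      - (\<Sum>y\<in>?N. (f y - f x) * (laplacian E f y - laplacian E f x))"
    \<comment> \<open>Only the outer Laplacian is expanded; \<open>laplacian E f\<close> has to stay
      folded for the regrouping that follows.\<close>
    by (simp only: laplacian_def[of E "Gamma_op E f f"]) (simp add: Gamma_op_eq)
  also have "(\<Sum>y\<in>?N. (f y - f x) * (laplacian E f y - laplacian E f x))
      = (\<Sum>y\<in>?N. (f y - f x) * laplacian E f y) - (\<Sum>y\<in>?N. f y - f x) * laplacian E f x"
    by (simp add: sum_distrib_right right_diff_distrib flip: sum_subtractf)
  also have "(\<Sum>y\<in>?N. f y - f x) = laplacian E f x"
    by (simp add: laplacian_def)
  finally show ?thesis
    by (simp add: sum_subtractf vertex_degree_def power2_eq_square)
qed

text \<open>With \<open>a = f z - f y\<close> and \<open>b = f y - f x\<close>, the inequality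
  \<open>(a - b)^2 >= 0\<close> gives \<open>a^2/2 - a b >= - b^2/2\<close>. Summing over the
  neighbours \<open>z\<close> of \<open>y\<close> costs the degree of \<open>y\<close>. Bounding
  that degree by the sum of the degrees of all neighbours of \<open>x\<close> makes the constant
  independent of \<open>y\<close>, so that \<open>Gamma_op E f f x\<close> factors out.\<close>

lemma Gamma2_op_self_lower_bound:
  "2 * Gamma2_op E f f x \<ge>
     - (real (\<Sum>y\<in>neighbours E x. vertex_degree E y) + real (vertex_degree E x)) * Gamma_op E f f x"
proof -
  let ?N = "neighbours E x"
  let ?D = "real (\<Sum>y\<in>?N. vertex_degree E y)"
  have "- ?D * Gamma_op E f f x = (\<Sum>y\<in>?N. - (?D * (f y - f x)\<^sup>2 / 2))"
    by (simp add: Gamma_op_self_eq sum_negf sum_distrib_left sum_divide_distrib)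
  also have "\<dots> \<le> (\<Sum>y\<in>?N. Gamma_op E f f y - (f y - f x) * laplacian E f y)"
  \<comment> \<open>Over an infinite neighbourhood both sums are 0 by convention.\<close>
  proof (cases "finite ?N")
    case True
    show ?thesis
    proof (rule sum_mono)
      fix y assume y: "y \<in> ?N"
      have "vertex_degree E y \<le> (\<Sum>y\<in>?N. vertex_degree E y)"
        using True y by (intro member_le_sum) auto
      then have "real (vertex_degree E y) * (f y - f x)\<^sup>2 \<le> ?D * (f y - f x)\<^sup>2"
        by (intro mult_right_mono) (simp_all del: of_nat_sum)
      then have "- (?D * (f y - f x)\<^sup>2 / 2) \<le> (\<Sum>z\<in>neighbours E y. - ((f y - f x)\<^sup>2 / 2))"
        by (simp add: vertex_degree_def del: of_nat_sum)
      also have "\<dots> \<le> (\<Sum>z\<in>neighbours E y. (f z - f y)\<^sup>2 / 2 - (f y - f x) * (f z - f y))"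
      proof (rule sum_mono)
        fix z
        show "- ((f y - f x)\<^sup>2 / 2) \<le> (f z - f y)\<^sup>2 / 2 - (f y - f x) * (f z - f y)"
          using zero_le_power2[of "(f z - f y) - (f y - f x)"]
          unfolding power2_diff[of "f z - f y"] by argo
      qed
      also have "\<dots> = Gamma_op E f f y - (f y - f x) * laplacian E f y"
        unfolding Gamma_op_self_eq laplacian_def sum_distrib_left sum_divide_distrib
        by (rule sum_subtractf)
      finally show "- (?D * (f y - f x)\<^sup>2 / 2) \<le> Gamma_op E f f y - (f y - f x) * laplacian E f y" .
    qed
  qed simp
  finally show ?thesis
    using zero_le_power2[of "laplacian E f x"]
    unfolding Gamma2_op_self_eq minus_add_distrib distrib_right by linarith
qed

lemma curvature_dimension_exists:
  assumes "real_of_ereal (1 / N) \<ge> 0"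
  shows "\<exists>K. curvature_dimension E x N K"
proof
  let ?t = "real_of_ereal (1 / N)"
  let ?D = "real (\<Sum>y\<in>neighbours E x. vertex_degree E y)"
  let ?d = "real (vertex_degree E x)"
  show "curvature_dimension E x N (- (?D + ?d) / 2 - ?t * (2 * ?d))"
    unfolding curvature_dimension_def
  proof
    fix f :: "'a \<Rightarrow> real"
    have "?t * (laplacian E f x)\<^sup>2 \<le> ?t * (2 * ?d * Gamma_op E f f x)"
      using assms laplacian_square_le by (rule mult_left_mono[rotated])
    moreover have "2 * Gamma2_op E f f x \<ge> - (?D + ?d) * Gamma_op E f f x"
      by (rule Gamma2_op_self_lower_bound)
    ultimately show "Gamma2_op E f f x
        \<ge> ?t * (laplacian E f x)\<^sup>2 + (- (?D + ?d) / 2 - ?t * (2 * ?d)) * Gamma_op E f f x"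
      by (simp add: algebra_simps add_divide_distrib diff_divide_distrib del: of_nat_sum)
  qed
qed

text \<open>A single test function with positive \<Gamma> at \<open>x\<close> bounds every
  admissible \<open>K\<close>. The indicator of \<open>x\<close> differs by 1 along each edge at
  \<open>x\<close>, so its \<Gamma> there is half the degree.\<close>

lemma curvature_dimension_bdd_above:
  assumes "x \<notin> neighbours E x" and "vertex_degree E x \<ge> 1"
  shows "bdd_above {K. curvature_dimension E x N K}"
proof -
  define f :: "'a \<Rightarrow> real" where "f = indicator {x}"
  let ?c = "Gamma2_op E f f x - real_of_ereal (1 / N) * (laplacian E f x)\<^sup>2"
  have "(\<Sum>y\<in>neighbours E x. (f y - f x)\<^sup>2) = (\<Sum>y\<in>neighbours E x. 1)"
    using assms(1) by (intro sum.cong) (auto simp: f_def indicator_def)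
  then have pos: "Gamma_op E f f x > 0"
    using assms(2) by (simp add: Gamma_op_self_eq vertex_degree_def)
  have "K \<le> ?c / Gamma_op E f f x" if "curvature_dimension E x N K" for K
    using that[unfolded curvature_dimension_def, rule_format, of f] pos
    by (simp add: pos_le_divide_eq)
  then show ?thesis
    by (intro bdd_aboveI) blast
qed

text \<open>Each \<open>f\<close> imposes a closed condition on \<open>K\<close>, and closedness
  survives intersection. This is what makes the supremum a maximum.\<close>

lemma closed_curvature_dimension: "closed {K. curvature_dimension E x N K}"
  unfolding curvature_dimension_def
  by (intro closed_Collect_all closed_Collect_le continuous_intros)

lemma
  assumes "x \<notin> neighbours E x" and "vertex_degree E x \<ge> 1" and "real_of_ereal (1 / N) \<ge> 0"
  shows curvature_dimension_curvature_function:
      "curvature_dimension E x N (curvature_function E x N)"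
    and curvature_function_upper:
      "curvature_dimension E x N K \<Longrightarrow> K \<le> curvature_function E x N"
proof -
  let ?S = "{K. curvature_dimension E x N K}"
  have bdd: "bdd_above ?S"
    using assms(1,2) by (rule curvature_dimension_bdd_above)
  have Sup: "Sup ?S \<in> ?S"
    using curvature_dimension_exists[OF assms(3)] bdd closed_curvature_dimension
    by (intro closed_contains_Sup) auto
  have upper: "K \<le> Sup ?S" if "curvature_dimension E x N K" for K
    using that bdd by (intro cSup_upper) auto
  have "curvature_function E x N = Sup ?S"
    unfolding curvature_function_def using Sup upper by (intro Greatest_equality) auto
  then show "curvature_dimension E x N (curvature_function E x N)"
    and "curvature_dimension E x N K \<Longrightarrow> K \<le> curvature_function E x N"
    using Sup upper by auto
qed

lemma curvature_dimension_mono: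
  assumes "curvature_dimension E x N K" and "real_of_ereal (1 / M) \<le> real_of_ereal (1 / N)"
  shows "curvature_dimension E x M K"
  unfolding curvature_dimension_def
proof
  fix f :: "'a \<Rightarrow> real"
  have "real_of_ereal (1 / M) * (laplacian E f x)\<^sup>2 \<le> real_of_ereal (1 / N) * (laplacian E f x)\<^sup>2"
    using assms(2) by (rule mult_right_mono) simp
  then show "Gamma2_op E f f x
      \<ge> real_of_ereal (1 / M) * (laplacian E f x)\<^sup>2 + K * Gamma_op E f f x"
    using assms(1)[unfolded curvature_dimension_def, rule_format, of f] by linarith
qed

text \<open>The weights act on the reciprocals of the dimensions, since the inequality is affine in
  \<open>1 / N\<close> and not in \<open>N\<close>.\<close>

lemma curvature_dimension_convex:
  assumes "curvature_dimension E x N K" and "curvature_dimension E x M L"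
    and "u \<ge> 0" "v \<ge> 0" "u + v = 1"
    and "real_of_ereal (1 / P) = u * real_of_ereal (1 / N) + v * real_of_ereal (1 / M)"
  shows "curvature_dimension E x P (u * K + v * L)"
  unfolding curvature_dimension_def
proof
  fix f :: "'a \<Rightarrow> real"
  let ?G = "Gamma_op E f f x" and ?l = "(laplacian E f x)\<^sup>2"
  have "u * (real_of_ereal (1 / N) * ?l + K * ?G) + v * (real_of_ereal (1 / M) * ?l + L * ?G)
      \<le> Gamma2_op E f f x"
    using assms(1,2)[unfolded curvature_dimension_def, rule_format, of f] assms(3-5)
    by (rule convex_bound_le)
  then show "Gamma2_op E f f x \<ge> real_of_ereal (1 / P) * ?l + (u * K + v * L) * ?G"
    by (simp add: assms(6) algebra_simps)
qed

lemma real_of_ereal_inverse_antimono: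
  assumes "0 < N" "N \<le> M"
  shows "real_of_ereal (1 / M) \<le> real_of_ereal (1 / N)"
  using assms by (cases N; cases M) (auto simp: one_ereal_def frac_le)

lemma real_of_ereal_inverse_strict_antimono:
  assumes "0 < N" "N < M"
  shows "real_of_ereal (1 / M) < real_of_ereal (1 / N)"
  using assms by (cases N; cases M) (auto simp: one_ereal_def frac_less2)

lemma real_of_ereal_inverse_nonneg:
  assumes "0 < N"
  shows "real_of_ereal (1 / N) \<ge> 0"
  using assms by (cases N) (auto simp: one_ereal_def)

theorem proposition4p5:
  fixes V :: "'a set" and E :: "'a set set" and x :: 'a and N1 N2 :: ereal
  assumes "locally_finite_graph V E"
    and "x \<in> V"
    and "vertex_degree E x \<ge> 1"
    and "N1 \<in> {0<..\<infinity>}"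
    and "N2 \<in> {0<..\<infinity>}"
    and "N1 < N2"
    and "curvature_function E x N1 = curvature_function E x N2"
  shows "\<forall>N\<in>{N1..\<infinity>}. curvature_function E x N = curvature_function E x N1"
proof
  fix N assume "N \<in> {N1..\<infinity>}"
  then have N: "N1 \<le> N" "0 < N"
    using assms(4) by (auto intro: less_le_trans)
  \<comment> \<open>A loop would be the set \<open>{x, x} = {x}\<close>, whose cardinality is not
    2.\<close>
  have x: "x \<notin> neighbours E x"
    using locally_finite_graph.edges[OF assms(1), of "{x}"] by (auto simp: neighbours_def)
  let ?K = "curvature_function E x" and ?t = "\<lambda>N. real_of_ereal (1 / N)"
  have holds: "curvature_dimension E x M (?K M)" if "0 < M" for M
    using x assms(3) real_of_ereal_inverse_nonneg[OF that]
    by (rule curvature_dimension_curvature_function)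
  have upper: "K \<le> ?K M" if "0 < M" "curvature_dimension E x M K" for M K
    using x assms(3) real_of_ereal_inverse_nonneg[OF that(1)] that(2)
    by (rule curvature_function_upper)
  have mono: "?K M \<le> ?K M'" if "0 < M" "M \<le> M'" for M M'
  proof (rule upper)
    show "0 < M'"
      using that by (rule less_le_trans)
    show "curvature_dimension E x M' (?K M)"
      using holds[OF that(1)] real_of_ereal_inverse_antimono[OF that]
      by (rule curvature_dimension_mono)
  qed
  have "?K N \<le> ?K N1"
  proof (cases "N \<le> N2")
    case True
    then show ?thesis
      using mono[OF N(2)] assms(7) by simp
  next
    case False
    then have "?t N < ?t N2" and "?t N2 < ?t N1"
      using assms(4-6) by (auto intro!: real_of_ereal_inverse_strict_antimono)
    \<comment> \<open>The weight that places \<open>?t N2\<close> strictly between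
      \<open>?t N\<close> and \<open>?t N1\<close>.\<close>
    define u where "u = (?t N1 - ?t N2) / (?t N1 - ?t N)"
    have u: "0 < u" "u < 1"
      using \<open>?t N < ?t N2\<close> \<open>?t N2 < ?t N1\<close> by (simp_all add: u_def)
    have "u * (?t N1 - ?t N) = ?t N1 - ?t N2"
      using \<open>?t N < ?t N2\<close> \<open>?t N2 < ?t N1\<close> by (simp add: u_def)
    then have "?t N2 = u * ?t N + (1 - u) * ?t N1"
      by (simp add: algebra_simps)
    then have "curvature_dimension E x N2 (u * ?K N + (1 - u) * ?K N1)"
      using u N(2) assms(4)
      by (intro curvature_dimension_convex[OF holds holds]) auto
    \<comment> \<open>The bound by maximality at \<open>N2\<close> is \<open>?K N2\<close>, which
      equals \<open>?K N1\<close> by hypothesis; what remains is cancelling the positive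
      \<open>u\<close>.\<close>
    then have "u * ?K N + (1 - u) * ?K N1 \<le> ?K N1"
      using upper[of N2] assms(5,7) by simp
    then have "u * ?K N \<le> u * ?K N1"
      by (simp add: algebra_simps)
    then show ?thesis
      using u(1) by simp
  qed
  moreover have "?K N1 \<le> ?K N"
    using assms(4) N(1) by (intro mono) auto
  ultimately show "?K N = ?K N1"
    by simp
qed

end
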